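(* Let $n\ge3$ be odd. For $0\le\ell\le\mathbf{d}_n$, $$\binom{n}{\ell+1}\mathbf{B}_{n-(\ell+1)}=(\ell+2)\sum_{k=0}^{\ell}\binom{k+2}{\ell-k}\left(\frac12\right)^{k+2}\mathfrak{f}_{n,k}.$$ In particular, for $\ell\ge3$ the sum runs only over $\lfloor(\ell-1)/2\rfloor\le k\le\ell$, because the remaining binomial coefficients vanish.
   Context: Bernoulli polynomials: $\frac{te^{xt}}{e^t-1}=\sum_{n\ge0}\mathbf{B}_n(x)\frac{t^n}{n!}$, and $\mathbf{B}_n=\mathbf{B}_n(0)$ (so $\mathbf{B}_1=-\frac12$). Power sums: $S_n(x)=\frac{1}{n+1}(\mathbf{B}_{n+1}(x)-\mathbf{B}_{n+1})$ for $n\ge0$, so that $S_n(m)=\sum_{\nu=0}^{m-1}\nu^n$; in particular $S_1(x)=\binom{x}{2}$. Faulhaber polynomials for odd index (classical Faulhaber–Jacobi theorem): for each odd $n\ge3$ there is a unique polynomial $F_n\in\mathbb{Q}[y]$, of degree $\mathbf{d}_n=\lfloor n/2\rfloor-1=(n-3)/2$, such that $S_n(x)=S_1(x)^2\,F_n(S_1(x))$. Its coefficients are denoted $F_n(y)=\sum_{k=0}^{\mathbf{d}_n}\mathfrak{f}_{n,k}\,y^k$. *)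

theory Defs
  imports "HOL-Computational_Algebra.Computational_Algebra"
begin

(* Both fps_X * fps_exp x and fps_exp 1 - 1 are divisible by fps_X, the latter exactly once, so the
   quotient below is the exact quotient in the ring of formal power series over the rationals
   (see bernpoly_gf). *)
definition bernpoly :: "nat \<Rightarrow> rat \<Rightarrow> rat" where
  "bernpoly n x = fact n * fps_nth (fps_X * fps_exp x / (fps_exp 1 - 1)) n"

definition bernoulli :: "nat \<Rightarrow> rat" where
  "bernoulli n = bernpoly n 0"

definition power_sum :: "nat \<Rightarrow> rat \<Rightarrow> rat" where
  "power_sum n x = (bernpoly (n + 1) x - bernoulli (n + 1)) / of_nat (n + 1)"

(* Truncated subtraction is harmless for n >= 3, the only case that is used. *)
definition faulhaber_degree :: "nat \<Rightarrow> nat" where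
  "faulhaber_degree n = n div 2 - 1"

(* Both sides of S_n(x) = S_1(x)^2 F(S_1(x)) are polynomial in x, so requiring the identity at every
   rational x is the same as requiring it between polynomials. *)
definition is_faulhaber_poly :: "nat \<Rightarrow> rat poly \<Rightarrow> bool" where
  "is_faulhaber_poly n F \<longleftrightarrow>
     degree F = faulhaber_degree n \<and>
     (\<forall>x. power_sum n x = (power_sum 1 x)\<^sup>2 * poly F (power_sum 1 x))"

(* Well-defined for odd n >= 3 by ex1_faulhaber_poly. *)
definition faulhaber_poly :: "nat \<Rightarrow> rat poly" where
  "faulhaber_poly n = (THE F. is_faulhaber_poly n F)"

definition faulhaber_coeff :: "nat \<Rightarrow> nat \<Rightarrow> rat" where
  "faulhaber_coeff n k = coeff (faulhaber_poly n) k"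


lemma bernpoly_gf:
  "Abs_fps (\<lambda>n. bernpoly n x / fact n) * (fps_exp 1 - 1) = fps_X * fps_exp x"
proof -
  define D where "D = fps_shift 1 (fps_exp 1 - 1 :: rat fps)"
  have D: "fps_exp 1 - 1 = D * fps_X"
    by (rule fps_ext) (auto simp: D_def)
  have D0: "fps_nth D 0 = 1" by (simp add: D_def)
  have ne: "fps_exp 1 - (1 :: rat fps) \<noteq> 0" by simp
  have "fps_X * fps_exp x = (fps_exp x * inverse D) * (fps_exp 1 - 1)"
    using inverse_mult_eq_1[of D] D0 by (simp add: D mult_ac)
  moreover from this have "fps_X * fps_exp x / (fps_exp 1 - 1) = fps_exp x * inverse D"
    using ne nonzero_mult_div_cancel_right[of "fps_exp 1 - (1 :: rat fps)" "fps_exp x * inverse D"]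
    by metis
  moreover have "Abs_fps (\<lambda>n. bernpoly n x / fact n) = fps_X * fps_exp x / (fps_exp 1 - 1)"
    by (rule fps_ext) (simp add: bernpoly_def)
  ultimately show ?thesis by simp
qed

lemma bernpoly_gf_mult:
  "Abs_fps (\<lambda>n. bernpoly n (x + y) / fact n) = fps_exp y * Abs_fps (\<lambda>n. bernpoly n x / fact n)"
proof -
  have "Abs_fps (\<lambda>n. bernpoly n (x + y) / fact n) * (fps_exp 1 - 1) =
        (fps_exp y * Abs_fps (\<lambda>n. bernpoly n x / fact n)) * (fps_exp 1 - 1)"
    by (simp only: mult.assoc bernpoly_gf) (simp add: fps_exp_add_mult mult_ac)
  thus ?thesis by (subst (asm) mult_right_cancel) auto
qed

lemma bernpoly_altdef:
  "bernpoly n x = (\<Sum>k\<le>n. of_nat (n choose k) * bernoulli k * x ^ (n - k))"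
proof -
  have "Abs_fps (\<lambda>n. bernpoly n x / fact n) =
          Abs_fps (\<lambda>n. bernoulli n / fact n) * fps_exp x"
    using bernpoly_gf_mult[of 0 x] by (simp add: bernoulli_def mult_ac)
  hence "fps_nth (Abs_fps (\<lambda>n. bernpoly n x / fact n)) n =
         fps_nth (Abs_fps (\<lambda>n. bernoulli n / fact n) * fps_exp x) n" by simp
  hence "bernpoly n x / fact n = (\<Sum>k\<le>n. bernoulli k / fact k * (x ^ (n - k) / fact (n - k)))"
    by (simp only: fps_mult_nth fps_nth_Abs_fps fps_exp_nth atLeast0AtMost of_nat_fact)
  hence "bernpoly n x = fact n * (\<Sum>k\<le>n. bernoulli k / fact k * (x ^ (n - k) / fact (n - k)))"
    by (metis fact_nonzero nonzero_mult_div_cancel_left times_divide_eq_right)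
  also have "\<dots> = (\<Sum>k\<le>n. of_nat (n choose k) * bernoulli k * x ^ (n - k))"
    unfolding sum_distrib_left
    by (intro sum.cong) (auto simp: binomial_fact field_simps)
  finally show ?thesis .
qed

lemma bernpoly_diff: "bernpoly (Suc n) (x + 1) - bernpoly (Suc n) x = of_nat (Suc n) * x ^ n"
proof -
  have "Abs_fps (\<lambda>n. bernpoly n (x + 1) / fact n) - Abs_fps (\<lambda>n. bernpoly n x / fact n) =
        Abs_fps (\<lambda>n. bernpoly n x / fact n) * (fps_exp 1 - 1)"
    by (simp only: bernpoly_gf_mult[of x 1]) (simp add: algebra_simps)
  also have "\<dots> = fps_X * fps_exp x" by (rule bernpoly_gf)
  finally have "fps_nth (Abs_fps (\<lambda>n. bernpoly n (x + 1) / fact n) -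
      Abs_fps (\<lambda>n. bernpoly n x / fact n)) (Suc n) = fps_nth (fps_X * fps_exp x) (Suc n)" by simp
  hence "(bernpoly (Suc n) (x + 1) - bernpoly (Suc n) x) / fact (Suc n) = x ^ n / fact n"
    by (simp add: diff_divide_distrib)
  hence "bernpoly (Suc n) (x + 1) - bernpoly (Suc n) x = fact (Suc n) * (x ^ n / fact n)"
    by (metis fact_nonzero nonzero_mult_div_cancel_left times_divide_eq_right)
  thus ?thesis by simp
qed

lemma power_sum_of_nat: "power_sum n (of_nat m) = (\<Sum>\<nu><m. of_nat \<nu> ^ n)"
proof (induction m)
  case 0
  show ?case by (simp add: power_sum_def bernoulli_def)
next
  case (Suc m)
  have "power_sum n (of_nat (Suc m)) = power_sum n (of_nat m) + of_nat m ^ n"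
    using bernpoly_diff[of n "of_nat m"]
    by (simp add: power_sum_def field_simps)
  with Suc.IH show ?case by simp
qed

lemma bernoulli_0: "bernoulli 0 = 1"
  using arg_cong[OF bernpoly_gf[of 0], of "\<lambda>f. fps_nth f 1"]
  by (simp add: bernoulli_def fps_mult_nth)

lemma bernoulli_1: "bernoulli 1 = - 1 / 2"
  using arg_cong[OF bernpoly_gf[of 0], of "\<lambda>f. fps_nth f 2"] bernoulli_0
  by (simp add: bernoulli_def fps_mult_nth eval_nat_numeral)

lemma power_sum_1: "power_sum 1 x = x * (x - 1) / 2"
proof -
  have "{..Suc (Suc 0)} = {0, 1, 2::nat}" by auto
  thus ?thesis
    using bernoulli_0 bernoulli_1
    by (simp add: power_sum_def bernpoly_altdef field_simps power2_eq_square eval_nat_numeral)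
qed

lemma bernpoly_reflect: "bernpoly n (1 - x) = (-1) ^ n * bernpoly n x"
proof -
  define A where "A x = Abs_fps (\<lambda>n. bernpoly n x / fact n)" for x
  have gf: "A x * (fps_exp 1 - 1) = fps_X * fps_exp x" for x
    unfolding A_def by (rule bernpoly_gf)
  have "(A x * (fps_exp 1 - 1)) oo (- fps_X) = (fps_X * fps_exp x) oo (- fps_X)"
    by (simp only: gf)
  hence "(A x oo (- fps_X)) * (fps_exp (-1) - 1) = - fps_X * fps_exp (- x)"
    by (simp add: fps_compose_mult_distrib fps_compose_sub_distrib)
  hence "(A x oo (- fps_X)) * (fps_exp (-1) - 1) * fps_exp 1 = - fps_X * fps_exp (- x) * fps_exp 1"
    by simp
  moreover have "fps_exp (-1) * fps_exp 1 = (1 :: rat fps)"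
    by (simp flip: fps_exp_add_mult)
  moreover have "fps_exp (- x) * fps_exp 1 = fps_exp (1 - x)"
    by (simp flip: fps_exp_add_mult)
  ultimately have "(A x oo (- fps_X)) * (fps_exp 1 - 1) = fps_X * fps_exp (1 - x)"
    by (simp add: left_diff_distrib right_diff_distrib mult.assoc) (simp add: algebra_simps)
  also have "\<dots> = A (1 - x) * (fps_exp 1 - 1)" by (simp add: gf)
  finally have "A (1 - x) = A x oo (- fps_X)" by simp
  hence "fps_nth (A (1 - x)) n = fps_nth (A x oo (- fps_X)) n" by simp
  thus ?thesis by (simp add: A_def fps_compose_uminus' field_simps)
qed

lemma bernoulli_odd_eq_0:
  assumes "odd n" "n \<ge> 3"
  shows   "bernoulli n = 0"
proof -
  obtain m where m: "n = Suc m" "m \<noteq> 0" using assms by (cases n) auto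
  have "bernpoly n 1 = bernpoly n 0"
    using bernpoly_diff[of m 0] m by (simp add: power_0_left)
  with bernpoly_reflect[of n 0] assms show ?thesis by (simp add: bernoulli_def)
qed

lemma symmetric_poly_decompose:
  fixes p :: "rat poly"
  assumes "pcompose p [:1, -1:] = p"
  shows   "\<exists>q. p = pcompose q [:0, - 1 / 2, 1 / 2:]"
  using assms
proof (induction "degree p" arbitrary: p rule: less_induct)
  case less
  define c where "c = poly p 0"
  show ?case
  proof (cases "degree p = 0")
    case True
    then obtain a where "p = [:a:]" by (rule degree_eq_zeroE)
    thus ?thesis by (intro exI[of _ "[:a:]"]) simp
  next
    case False
    define p' where "p' = p - [:c:]"
    have deg: "degree p' = degree p" unfolding p'_def using False
      by (metis degree_add_eq_left degree_minus degree_pCons_0 diff_conv_add_uminus neq0_conv)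
    have "poly p 1 = poly p 0"
      using arg_cong[OF less.prems, of "\<lambda>p. poly p 0"] by (simp add: poly_pcompose)
    hence roots: "poly p' 0 = 0" "poly p' 1 = 0" by (auto simp: p'_def c_def)
    then obtain s where s: "p' = [:0, 1:] * s" by (auto simp: poly_eq_0_iff_dvd)
    with roots have "poly s 1 = 0" by simp
    then obtain r where "s = [:-1, 1:] * r" by (auto simp: poly_eq_0_iff_dvd)
    with s have r: "p' = [:0, -1, 1:] * r" by simp
    have "p' \<noteq> 0" using deg False by auto
    hence "r \<noteq> 0" using r by auto
    hence "degree p' = degree r + 2" unfolding r by (subst degree_mult_eq) auto
    hence less': "degree r < degree p" using deg by simp
    have "[:0, -1, 1:] * pcompose r [:1, -1:] = pcompose p' [:1, -1:]"
      unfolding r pcompose_mult by (simp add: pcompose_pCons)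
    also have "\<dots> = p'" using less.prems by (simp add: p'_def pcompose_diff pcompose_pCons)
    also have "\<dots> = [:0, -1, 1:] * r" by (rule r)
    finally have "pcompose r [:1, -1:] = r" by (subst (asm) mult_left_cancel) auto
    from less.hyps[OF less' this] obtain q where q: "r = pcompose q [:0, - 1 / 2, 1 / 2:]" by auto
    have "p = [:c:] + [:0, -1, 1:] * r" using r by (simp add: p'_def algebra_simps)
    hence "p = pcompose (pCons c (smult 2 q)) [:0, - 1 / 2, 1 / 2:]"
      by (simp add: q pcompose_pCons pcompose_smult smult_diff_right)
    thus ?thesis by blast
  qed
qed

lemma ex1_faulhaber_poly:
  assumes "odd n" "n \<ge> 3"
  shows   "\<exists>!F. is_faulhaber_poly n F"
proof -
  define N where "N = n + 1"
  have N: "even N" "N \<ge> 4" using assms by (auto simp: N_def)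
  define y where "y = [:0, - 1 / 2, 1 / 2 :: rat:]"
  have y: "poly y x = power_sum 1 x" for x
    unfolding power_sum_1 y_def by (simp add: field_simps)
  have y_nz: "y \<noteq> 0" and deg_y: "degree y = 2" by (auto simp: y_def)
  define p where "p = smult (1 / of_nat N)
     (\<Sum>k<N. monom (of_nat (N choose k) * bernoulli k) (N - k))"
  have p: "poly p x = power_sum n x" for x
  proof -
    have "bernpoly N x - bernoulli N =
            (\<Sum>k<N. of_nat (N choose k) * bernoulli k * x ^ (N - k))"
      unfolding bernpoly_altdef lessThan_Suc_atMost[symmetric] by simp
    thus ?thesis by (simp add: p_def power_sum_def poly_sum poly_monom N_def)
  qed
  have coeff_p: "coeff p j = (if j \<in> {1..N} then of_nat (N choose j) * bernoulli (N - j) / of_nat N else 0)" for j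
  proof -
    have "coeff p j = (\<Sum>k<N. if k = N - j \<and> j \<in> {1..N} then of_nat (N choose k) * bernoulli k else 0) / of_nat N"
      by (auto simp: p_def coeff_sum intro!: sum.cong)
    also have "\<dots> = (if j \<in> {1..N} then of_nat (N choose (N - j)) * bernoulli (N - j) else 0) / of_nat N"
      by (cases "j \<in> {1..N}") auto
    finally show ?thesis by (auto simp flip: binomial_symmetric)
  qed
  have deg_p: "degree p = N"
  proof (rule antisym)
    show "degree p \<le> N" by (rule degree_le) (auto simp: coeff_p)
    show "N \<le> degree p" using N by (intro le_degree) (auto simp: coeff_p bernoulli_0)
  qed
  have "pcompose p [:1, -1:] = p"
  proof (rule iffD1[OF poly_eq_poly_eq_iff], rule ext)
    fix x
    show "poly (pcompose p [:1, -1:]) x = poly p x"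
      using N bernpoly_reflect[of N x] by (simp add: poly_pcompose p power_sum_def N_def)
  qed
  then obtain q where q: "p = pcompose q y"
    unfolding y_def using symmetric_poly_decompose by blast
  have deg_q: "2 * degree q = N" using deg_p deg_y by (simp add: q degree_pcompose)
  have q0: "coeff q 0 = 0"
    using coeff_p[of 0] by (simp add: q y_def flip: poly_0_coeff_0) (simp add: poly_pcompose)
  have "coeff p 1 = 0"
    using N bernoulli_odd_eq_0[of "N - 1"] by (simp add: coeff_p)
  moreover have "coeff p 1 = poly (pderiv p) 0"
    by (simp add: poly_0_coeff_0 coeff_pderiv)
  moreover have "poly (pderiv p) 0 = poly (pderiv q) 0 * (- 1 / 2)"
    by (simp add: q pderiv_pcompose poly_pcompose y_def pderiv_pCons)
  ultimately have q1: "coeff q 1 = 0"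
    by (simp add: poly_0_coeff_0 coeff_pderiv)
  obtain a b F where F: "q = pCons a (pCons b F)" by (metis pCons_cases)
  with q0 q1 have F: "q = pCons 0 (pCons 0 F)" by simp
  have "F \<noteq> 0" using F deg_q N by auto
  hence "degree F = faulhaber_degree n"
    using F deg_q by (simp add: faulhaber_degree_def N_def)
  moreover have "power_sum n x = (power_sum 1 x)\<^sup>2 * poly F (power_sum 1 x)" for x
    unfolding p[symmetric] q by (simp add: poly_pcompose F y power2_eq_square)
  ultimately have ex: "is_faulhaber_poly n F" by (simp add: is_faulhaber_poly_def)
  have "F1 = F2" if "is_faulhaber_poly n F1" "is_faulhaber_poly n F2" for F1 F2
  proof -
    have "y\<^sup>2 * pcompose F1 y = y\<^sup>2 * pcompose F2 y"
    proof (rule iffD1[OF poly_eq_poly_eq_iff], rule ext)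
      fix x show "poly (y\<^sup>2 * pcompose F1 y) x = poly (y\<^sup>2 * pcompose F2 y) x"
        using that unfolding is_faulhaber_poly_def by (simp add: poly_pcompose y) metis
    qed
    hence "pcompose (F1 - F2) y = 0" using y_nz by (simp add: pcompose_diff)
    hence "F1 - F2 = 0" using deg_y by (subst (asm) pcompose_eq_0_iff) auto
    thus ?thesis by simp
  qed
  with ex show ?thesis by blast
qed

end

theory Submission
  imports Defs
begin

text \<open>Substitute \<open>- x\<close> for \<open>x\<close> in \<open>S\<^sub>n(x) = S\<^sub>1(x)\<^sup>2 F\<^sub>n(S\<^sub>1(x))\<close>: as \<open>S\<^sub>1(- x) = x (x + 1) / 2\<close>, comparing the
  coefficients of \<open>x ^ (\<ell> + 2)\<close> gives the claim up to the sign \<open>(-1) ^ \<ell>\<close>. For odd \<open>\<ell>\<close> the sign is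
  immaterial, because then \<open>n - (\<ell> + 1)\<close> is odd and at least \<open>3\<close>, so that the Bernoulli number vanishes.\<close>

text \<open>In \<open>bernpoly_altdef\<close> at index \<open>n + 1\<close>, the term
  \<open>k = n + 1\<close> is the subtracted constant; reversing the index of the rest sorts it by
  powers of \<open>x\<close>.\<close>

lemma power_sum_eq_sum_powers:
  "power_sum n x =
     (\<Sum>j = 1..n + 1. of_nat (Suc n choose j) * bernoulli (Suc n - j) / of_nat (Suc n) * x ^ j)"
proof -
  have "bernpoly (Suc n) x - bernoulli (Suc n) =
          (\<Sum>k\<le>n. of_nat (Suc n choose k) * bernoulli k * x ^ (Suc n - k))"
    by (simp add: bernpoly_altdef)
  also have "\<dots> = (\<Sum>j = 1..n + 1. of_nat (Suc n choose j) * bernoulli (Suc n - j) * x ^ j)"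
    by (rule sum.reindex_bij_witness[of _ "\<lambda>j. Suc n - j" "\<lambda>k. Suc n - k"])
       (auto simp flip: binomial_symmetric)
  finally show ?thesis
    by (simp only: power_sum_def Suc_eq_plus1[symmetric] sum_divide_distrib times_divide_eq_left)
qed

lemma pronic_power: "[:0, 1, 1 :: 'a :: comm_ring_1:] ^ m = monom 1 m * [:1, 1:] ^ m"
proof -
  have "[:0, 1, 1:] = monom 1 1 * [:1, 1 :: 'a:]"
    by (simp add: monom_Suc monom_0)
  thus ?thesis by (simp only: power_mult_distrib monom_power) simp
qed

text \<open>The factor \<open>x ^ m\<close> of \<open>(x * (x + 1)) ^ m\<close> shifts the binomial
  expansion of \<open>(1 + x) ^ m\<close> by \<open>m\<close>.\<close>

lemma coeff_pronic_power:
  "coeff ([:0, 1, 1:] ^ m) (i + m) = (of_nat (m choose i) :: 'a :: comm_ring_1)"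
proof -
  have "coeff ([:0, 1, 1 :: 'a:] ^ m) (i + m) = coeff ([:1, 1:] ^ m) i"
    by (simp add: pronic_power coeff_monom_mult)
  also have "\<dots> = of_nat (m choose i)"
    by (cases "i \<le> m") (auto simp: coeff_linear_poly_power coeff_eq_0 degree_linear_power binomial_eq_0)
  finally show ?thesis .
qed

lemma coeff_pronic_power_eq_0:
  assumes "j < m"
  shows "coeff ([:0, 1, 1 :: 'a :: comm_ring_1:] ^ m) j = 0"
  using assms by (simp add: pronic_power coeff_monom_mult)

lemma is_faulhaber_poly_faulhaber_poly:
  assumes "odd n" "n \<ge> 3"
  shows "is_faulhaber_poly n (faulhaber_poly n)"
  unfolding faulhaber_poly_def by (rule theI'[OF ex1_faulhaber_poly[OF assms]])

text \<open>The exponent \<open>k + 2\<close> absorbs the factor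
  \<open>(power_sum 1 (- x))\<^sup>2\<close>. Working at \<open>- x\<close> gives powers of
  \<open>x * (x + 1)\<close>, so that no sign depends on \<open>k\<close>.\<close>

lemma power_sum_uminus_eq_faulhaber:
  assumes "odd n" "n \<ge> 3"
  shows "power_sum n (- x) =
           (\<Sum>k\<le>faulhaber_degree n. (1 / 2) ^ (k + 2) * faulhaber_coeff n k * (x * (x + 1)) ^ (k + 2))"
proof -
  have F: "degree (faulhaber_poly n) = faulhaber_degree n"
    "power_sum n (- x) = (power_sum 1 (- x))\<^sup>2 * poly (faulhaber_poly n) (power_sum 1 (- x))"
    using is_faulhaber_poly_faulhaber_poly[OF assms] by (auto simp: is_faulhaber_poly_def)
  have "power_sum 1 (- x) = 1 / 2 * (x * (x + 1))"
    unfolding power_sum_1 by (simp add: algebra_simps)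
  thus ?thesis unfolding F(2) poly_altdef F(1) sum_distrib_left faulhaber_coeff_def
    by (intro sum.cong) (simp_all only: power_mult_distrib power_add mult_ac)
qed

lemma binomial_bernoulli_eq_signed_faulhaber_sum:
  assumes "odd n" "n \<ge> 3" "l \<le> faulhaber_degree n"
  shows "of_nat (n choose (l + 1)) * bernoulli (n - (l + 1)) =
           (-1) ^ l * (of_nat (l + 2) * (\<Sum>k = 0..l.
             of_nat ((k + 2) choose (l - k)) * (1 / 2) ^ (k + 2) * faulhaber_coeff n k))"
proof -
  define d where "d = faulhaber_degree n"
  define c where "c k = (1 / 2) ^ (k + 2) * faulhaber_coeff n k" for k
  \<comment> \<open>\<open>b j\<close> is the coefficient of \<open>x ^ j\<close> in
    \<open>power_sum n x\<close>; \<open>P\<close> and \<open>Q\<close> are the two expansions of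
    \<open>power_sum n (- x)\<close>.\<close>
  define b where "b j = of_nat (Suc n choose j) * bernoulli (Suc n - j) / of_nat (Suc n)" for j
  define P where "P = (\<Sum>j = 1..n + 1. monom ((-1) ^ j * b j) j)"
  define Q where "Q = (\<Sum>k\<le>d. smult (c k) ([:0, 1, 1:] ^ (k + 2)))"
  have l: "l + 2 \<le> n + 1" using assms by (simp add: faulhaber_degree_def)
  have "poly P x = poly Q x" for x
  proof -
    have "poly P x = power_sum n (- x)"
      unfolding power_sum_eq_sum_powers P_def b_def poly_sum poly_monom
      by (intro sum.cong) (simp_all add: power_minus[of x])
    also have "\<dots> = poly Q x"
      unfolding power_sum_uminus_eq_faulhaber[OF assms(1,2)] Q_def c_def d_def poly_sum
      by (intro sum.cong) (simp_all add: poly_power algebra_simps)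
    finally show ?thesis .
  qed
  hence "P = Q" by (intro iffD1[OF poly_eq_poly_eq_iff] ext)
  hence "coeff P (l + 2) = coeff Q (l + 2)" by simp
  moreover have "coeff P (l + 2) = (-1) ^ l * b (l + 2)"
    using l by (simp add: P_def coeff_sum)
  moreover have "coeff Q (l + 2) = (\<Sum>k = 0..l. of_nat ((k + 2) choose (l - k)) * c k)"
  proof -
    have "coeff Q (l + 2) = (\<Sum>k\<le>d. c k * coeff ([:0, 1, 1:] ^ (k + 2)) (l + 2))"
      by (simp add: Q_def coeff_sum)
    \<comment> \<open>For \<open>k > l\<close> the power is divisible by \<open>x ^ (l + 3)\<close>
      and contributes nothing.\<close>
    also have "\<dots> = (\<Sum>k = 0..l. c k * coeff ([:0, 1, 1:] ^ (k + 2)) (l + 2))"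
      using assms(3) by (intro sum.mono_neutral_right) (auto simp: d_def coeff_pronic_power_eq_0 simp del: power_Suc)
    also have "\<dots> = (\<Sum>k = 0..l. of_nat ((k + 2) choose (l - k)) * c k)"
    proof (intro sum.cong refl)
      fix k assume "k \<in> {0..l}"
      hence "l + 2 = (l - k) + (k + 2)" by simp
      thus "c k * coeff ([:0, 1, 1:] ^ (k + 2)) (l + 2) = of_nat ((k + 2) choose (l - k)) * c k"
        using coeff_pronic_power[of "k + 2" "l - k", where 'a = rat] by (metis mult.commute)
    qed
    finally show ?thesis .
  qed
  \<comment> \<open>The absorption identity produces a factor \<open>n + 1\<close> that cancels the
    denominator of \<open>b\<close>.\<close>
  moreover have "of_nat (l + 2) * b (l + 2) = of_nat (n choose (l + 1)) * bernoulli (n - (l + 1))"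
  proof -
    have "(of_nat (l + 2) * of_nat (Suc n choose (l + 2)) :: rat) = of_nat (Suc n) * of_nat (n choose (l + 1))"
      using Suc_times_binomial[of "l + 1" n]
      by (simp only: add_2_eq_Suc' Suc_eq_plus1[symmetric] flip: of_nat_mult)
    thus ?thesis by (simp add: b_def divide_simps del: of_nat_Suc binomial_Suc_Suc)
  qed
  ultimately have eq: "(-1) ^ l * b (l + 2) = (\<Sum>k = 0..l. of_nat ((k + 2) choose (l - k)) * c k)"
    and b: "of_nat (n choose (l + 1)) * bernoulli (n - (l + 1)) = of_nat (l + 2) * b (l + 2)"
    by simp_all
  have "b (l + 2) = (-1) ^ l * ((-1) ^ l * b (l + 2))"
    by (simp flip: power_mult_distrib mult.assoc)
  thus ?thesis unfolding b eq c_def by (simp add: mult_ac)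
qed

theorem theorem5p4:
  fixes n l :: nat
  assumes "odd n" and "n \<ge> 3" and "l \<le> faulhaber_degree n"
  shows "of_nat (n choose (l + 1)) * bernoulli (n - (l + 1)) =
           of_nat (l + 2) * (\<Sum>k = 0..l.
             of_nat ((k + 2) choose (l - k)) * (1 / 2) ^ (k + 2) * faulhaber_coeff n k) \<and>
         (l \<ge> 3 \<longrightarrow>
           (\<forall>k < (l - 1) div 2. (k + 2) choose (l - k) = 0) \<and>
           of_nat (n choose (l + 1)) * bernoulli (n - (l + 1)) =
             of_nat (l + 2) * (\<Sum>k = (l - 1) div 2..l.
               of_nat ((k + 2) choose (l - k)) * (1 / 2) ^ (k + 2) * faulhaber_coeff n k))"
proof -
  let ?f = "\<lambda>k. of_nat ((k + 2) choose (l - k)) * (1 / 2) ^ (k + 2) * faulhaber_coeff n k"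
  have full: "of_nat (n choose (l + 1)) * bernoulli (n - (l + 1)) = of_nat (l + 2) * sum ?f {0..l}"
  proof (cases "even l")
    case True
    thus ?thesis using binomial_bernoulli_eq_signed_faulhaber_sum[OF assms] by simp
  next
    case False
    \<comment> \<open>From \<open>l \<le> (n - 3) / 2\<close> the index is at least
      \<open>(n + 1) / 2\<close>, hence at least 2, and oddness rules out 2. The left side is then
      0, and the signed identity forces the right side to be 0 too.\<close>
    with assms have "odd (n - (l + 1))" "n - (l + 1) \<ge> 2"
      by (auto simp: faulhaber_degree_def elim!: oddE)
    moreover from this have "n - (l + 1) \<noteq> 2" by (metis even_numeral)
    ultimately have "bernoulli (n - (l + 1)) = 0" by (intro bernoulli_odd_eq_0) auto
    thus ?thesis using binomial_bernoulli_eq_signed_faulhaber_sum[OF assms] by simp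
  qed
  \<comment> \<open>The bound on \<open>k\<close> gives \<open>2 * k + 3 \<le> l\<close>, so the
    lower entry \<open>l - k\<close> exceeds \<open>k + 2\<close>.\<close>
  have vanish: "(k + 2) choose (l - k) = 0" if "k < (l - 1) div 2" for k
    using that by (intro binomial_eq_0) linarith
  have "sum ?f {0..l} = sum ?f {(l - 1) div 2..l}"
    by (intro sum.mono_neutral_right) (auto simp: vanish simp del: binomial_Suc_Suc)
  with full vanish show ?thesis by simp
qed

end
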